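(* Let $d\ge 3$ be an integer. For every sufficiently large prime $p$ and every $q\in\mathbb{N}$ with $\gcd(p,q)\neq 1$, the group $G=C_p^{d-1}\times C_{pq}$ satisfies $D(G)=D^*(G)=pq+(d-1)(p-1)$.
   Context: All groups are finite abelian, written additively; $C_n$ is the cyclic group of order $n$. A sequence over $G$ is a finite multiset of elements of $G$; a sequence is zero-sum if the sum of its terms is $0$. $D(G)$ is the least positive integer $k$ such that every sequence over $G$ of length at least $k$ has a nonempty zero-sum subsequence. For $G=C_{n_1}\times\cdots\times C_{n_d}$ with $n_i\mid n_{i+1}$, $D^*(G)=1+\sum_{i=1}^d(n_i-1)$. *)

theory Defs
  imports
    "HOL-Algebra.FiniteProduct"
    "HOL-Algebra.Product_Groups"
    "HOL-Library.Multiset"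
    "HOL-Computational_Algebra.Primes"
begin

(* HOL-Algebra groups are written multiplicatively: the sum of the terms of a sequence
   is a finprod, and 0 is the unit of the group. *)

definition sequence_sum :: "('a, 'b) monoid_scheme \<Rightarrow> 'a multiset \<Rightarrow> 'a" where
  "sequence_sum G S = finprod G (\<lambda>x. x [^]\<^bsub>G\<^esub> count S x) (set_mset S)"

definition sequence_over :: "('a, 'b) monoid_scheme \<Rightarrow> 'a multiset \<Rightarrow> bool" where
  "sequence_over G S \<longleftrightarrow> set_mset S \<subseteq> carrier G"

definition zero_sum :: "('a, 'b) monoid_scheme \<Rightarrow> 'a multiset \<Rightarrow> bool" where
  "zero_sum G S \<longleftrightarrow> sequence_sum G S = \<one>\<^bsub>G\<^esub>"

definition davenport :: "('a, 'b) monoid_scheme \<Rightarrow> nat" where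
  "davenport G = (LEAST k. k > 0 \<and>
     (\<forall>S. sequence_over G S \<and> size S \<ge> k \<longrightarrow> (\<exists>T. T \<subseteq># S \<and> T \<noteq> {#} \<and> zero_sum G T)))"

(* integer_mod_group 0 is the infinite cyclic group, so positivity of the n i is needed. *)

definition divisor_chain :: "nat \<Rightarrow> (nat \<Rightarrow> nat) \<Rightarrow> bool" where
  "divisor_chain d n \<longleftrightarrow> (\<forall>i\<in>{1..d}. n i > 0) \<and> (\<forall>i\<in>{1..<d}. n i dvd n (i + 1))"

definition davenport_star :: "('a, 'b) monoid_scheme \<Rightarrow> nat" where
  "davenport_star G = (THE k. \<exists>d n. divisor_chain d n \<and>
     G \<cong> product_group {1..d} (\<lambda>i. integer_mod_group (n i)) \<and>
     k = 1 + (\<Sum>i=1..d. n i - 1))"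

(* The value of davenport_star does not depend on the chosen decomposition. Factors with
   n i = 1 are allowed and contribute nothing. *)

lemma divisor_chain_dvd_last:
  assumes "divisor_chain d n" "i \<in> {1..d}"
  shows "n i dvd n d"
proof -
  have "i \<le> j \<Longrightarrow> j \<le> d \<Longrightarrow> n i dvd n j" for j
  proof (induction j rule: dec_induct)
    case (step j)
    then have "n j dvd n (j + 1)"
      using assms unfolding divisor_chain_def by auto
    with step show ?case by (auto intro: dvd_trans)
  qed simp
  with assms(2) show ?thesis by auto
qed

lemma prod_gcd_eq_iff:
  fixes n :: "nat \<Rightarrow> nat"
  assumes "finite A" "\<And>i. i \<in> A \<Longrightarrow> n i > 0"
  shows "(\<Prod>i\<in>A. gcd k (n i)) = (\<Prod>i\<in>A. n i) \<longleftrightarrow> (\<forall>i\<in>A. n i dvd k)"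
proof
  assume eq: "(\<Prod>i\<in>A. gcd k (n i)) = (\<Prod>i\<in>A. n i)"
  show "\<forall>i\<in>A. n i dvd k"
  proof (rule ccontr)
    assume "\<not> (\<forall>i\<in>A. n i dvd k)"
    then obtain j where j: "j \<in> A" "\<not> n j dvd k" by blast
    have "gcd k (n j) < n j"
      using assms(2)[OF j(1)] j(2) by (metis gcd_dvd1 gcd_le2_nat le_neq_implies_less neq0_conv)
    moreover have "(\<Prod>i\<in>A - {j}. gcd k (n i)) \<le> (\<Prod>i\<in>A - {j}. n i)"
      by (rule prod_mono) (use assms(2) in auto)
    moreover have "(\<Prod>i\<in>A - {j}. n i) > 0"
      using assms(2) by (intro prod_pos) auto
    ultimately have "gcd k (n j) * (\<Prod>i\<in>A - {j}. gcd k (n i)) < n j * (\<Prod>i\<in>A - {j}. n i)"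
      by (metis le_less_trans mult.commute mult_le_mono2 mult_less_mono2)
    then have "(\<Prod>i\<in>A. gcd k (n i)) < (\<Prod>i\<in>A. n i)"
      using assms(1) j(1) by (simp add: prod.remove)
    with eq show False by simp
  qed
next
  assume "\<forall>i\<in>A. n i dvd k"
  then show "(\<Prod>i\<in>A. gcd k (n i)) = (\<Prod>i\<in>A. n i)"
    by (intro prod.cong) (auto simp: gcd_nat.absorb2)
qed

lemma divisor_chain_Suc: "divisor_chain (Suc d) n \<Longrightarrow> divisor_chain d n"
  unfolding divisor_chain_def by auto

lemma divisor_chain_sum_unique:
  assumes "divisor_chain d n" "divisor_chain e m"
    and "\<And>k. (\<Prod>i=1..d. gcd k (n i)) = (\<Prod>i=1..e. gcd k (m i))"
  shows "(\<Sum>i=1..d. n i - 1) = (\<Sum>i=1..e. m i - 1)"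
  using assms
proof (induction d arbitrary: e)
  case 0
  from 0(3)[of 0] have "(\<Prod>i=1..e. m i) = 1" by simp
  then have "\<forall>i\<in>{1..e}. m i = 1" by (metis prod_eq_1_iff finite_atLeastAtMost)
  then show ?case by simp
next
  case (Suc d)
  have pn: "n i > 0" if "i \<in> {1..Suc d}" for i
    using Suc.prems(1) that by (simp add: divisor_chain_def)
  have pm: "m i > 0" if "i \<in> {1..e}" for i
    using Suc.prems(2) that by (simp add: divisor_chain_def)
  have prods: "(\<Prod>i=1..Suc d. n i) = (\<Prod>i=1..e. m i)"
    using Suc.prems(3)[of 0] by simp
  have all_dvd: "(\<forall>i\<in>{1..Suc d}. n i dvd k) \<longleftrightarrow> (\<forall>i\<in>{1..e}. m i dvd k)" for k
    using prod_gcd_eq_iff[of "{1..Suc d}" n k] prod_gcd_eq_iff[of "{1..e}" m k]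
      Suc.prems(3)[of k] prods pn pm by simp
  show ?case
  proof (cases e)
    case 0
    with prods have "(\<Prod>i=1..Suc d. n i) = 1" by simp
    then have "\<forall>i\<in>{1..Suc d}. n i = 1" by (metis prod_eq_1_iff finite_atLeastAtMost)
    with 0 show ?thesis by simp
  next
    case (Suc e')
    have "\<forall>i\<in>{1..e}. m i dvd n (Suc d)"
      using all_dvd divisor_chain_dvd_last[OF Suc.prems(1)] by blast
    moreover have "\<forall>i\<in>{1..Suc d}. n i dvd m e"
      using all_dvd divisor_chain_dvd_last[OF Suc.prems(2)] by blast
    ultimately have last_eq: "n (Suc d) = m e"
      using Suc by (intro dvd_antisym) auto
    have "(\<Prod>i=1..d. gcd k (n i)) = (\<Prod>i=1..e'. gcd k (m i))" for k
    proof -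
      have "m (Suc e') > 0" using pm[of e] Suc by simp
      with Suc.prems(3)[of k] last_eq Suc show ?thesis by simp
    qed
    moreover have "divisor_chain d n" "divisor_chain e' m"
      using Suc.prems Suc divisor_chain_Suc by blast+
    ultimately have "(\<Sum>i=1..d. n i - 1) = (\<Sum>i=1..e'. m i - 1)"
      by (intro Suc.IH)
    with last_eq Suc show ?thesis by simp
  qed
qed

lemma card_torsion_integer_mod_group:
  assumes "n > 0"
  shows "card {x \<in> carrier (integer_mod_group n). x [^]\<^bsub>integer_mod_group n\<^esub> (k::nat) = 0} = gcd k n"
proof -
  define g where "g = gcd k n"
  obtain k' n' where kn: "k = k' * g" "n = n' * g" "coprime k' n'"
    unfolding g_def using gcd_coprime_exists[of k n] assms by auto
  have pos: "g > 0" "n' > 0" using assms kn(2) by auto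
  have "{x \<in> carrier (integer_mod_group n). x [^]\<^bsub>integer_mod_group n\<^esub> k = 0}
      = (\<lambda>j. int j * int n') ` {..<g}"
  proof (intro equalityI subsetI)
    fix x assume "x \<in> {x \<in> carrier (integer_mod_group n). x [^]\<^bsub>integer_mod_group n\<^esub> k = 0}"
    then have x: "0 \<le> x" "x < int n" "int n dvd int k * x"
      using assms by (auto simp: carrier_integer_mod_group mod_eq_0_iff_dvd)
    have "int g * int n' dvd int g * (int k' * x)"
      using x(3) kn by (simp add: mult_ac)
    then have "int n' dvd int k' * x" using pos by simp
    then have "int n' dvd x"
      using kn(3) by (metis coprime_commute coprime_dvd_mult_right_iff coprime_int_iff)
    then obtain j where j: "x = int n' * j" by (elim dvdE)
    have "0 \<le> j" using x(1) j pos by (simp add: zero_le_mult_iff)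
    moreover have "j < int g"
      using x(2) j kn(2) pos by (simp add: mult.commute)
    ultimately show "x \<in> (\<lambda>j. int j * int n') ` {..<g}"
      using j by (intro image_eqI[of _ _ "nat j"]) (auto simp: mult.commute nat_less_iff)
  next
    fix x assume "x \<in> (\<lambda>j. int j * int n') ` {..<g}"
    then obtain j where j: "j < g" "x = int j * int n'" by auto
    have "int k * x = int n * (int k' * int j)" using j kn by (simp add: mult_ac)
    then have "int n dvd int k * x" by simp
    moreover have "x < int n"
      using j pos kn(2) by (metis mult.commute mult_less_mono2 of_nat_less_iff of_nat_mult)
    ultimately show "x \<in> {x \<in> carrier (integer_mod_group n). x [^]\<^bsub>integer_mod_group n\<^esub> k = 0}"
      using assms j(2) by (auto simp: carrier_integer_mod_group simp del: of_nat_mult)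
  qed
  moreover have "inj_on (\<lambda>j. int j * int n') {..<g}" using pos by (auto simp: inj_on_def)
  ultimately show ?thesis by (simp add: card_image g_def)
qed

lemma pow_product_group:
  assumes "\<And>i. i \<in> I \<Longrightarrow> monoid (G i)" "x \<in> carrier (product_group I G)"
  shows "x [^]\<^bsub>product_group I G\<^esub> (k::nat) = (\<lambda>i\<in>I. x i [^]\<^bsub>G i\<^esub> k)"
  by (induction k) (auto simp: nat_pow_def fun_eq_iff)

lemma card_torsion_product_group:
  assumes "divisor_chain d n"
  defines "P \<equiv> product_group {1..d} (\<lambda>i. integer_mod_group (n i))"
  shows "card {x \<in> carrier P. x [^]\<^bsub>P\<^esub> (k::nat) = \<one>\<^bsub>P\<^esub>} = (\<Prod>i=1..d. gcd k (n i))"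
proof -
  let ?C = "\<lambda>i. integer_mod_group (n i)"
  have "x [^]\<^bsub>P\<^esub> k = (\<lambda>i\<in>{1..d}. x i [^]\<^bsub>?C i\<^esub> k)" if "x \<in> carrier P" for x
    using that unfolding P_def
    by (intro pow_product_group) (auto intro: group.is_monoid)
  moreover have "\<one>\<^bsub>P\<^esub> = (\<lambda>i\<in>{1..d}. 0)"
    by (simp add: P_def)
  ultimately have "x [^]\<^bsub>P\<^esub> k = \<one>\<^bsub>P\<^esub> \<longleftrightarrow> (\<forall>i\<in>{1..d}. x i [^]\<^bsub>?C i\<^esub> k = 0)" if "x \<in> carrier P" for x
    using that by (metis (no_types, lifting) restrict_apply' restrict_ext)
  moreover have memP: "x \<in> (\<Pi>\<^sub>E i\<in>{1..d}. {x \<in> carrier (?C i). x [^]\<^bsub>?C i\<^esub> k = 0}) \<longleftrightarrow>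
      x \<in> carrier P \<and> (\<forall>i\<in>{1..d}. x i [^]\<^bsub>?C i\<^esub> k = 0)" for x
    unfolding P_def carrier_product_group PiE_iff by blast
  ultimately have "{x \<in> carrier P. x [^]\<^bsub>P\<^esub> k = \<one>\<^bsub>P\<^esub>}
      = (\<Pi>\<^sub>E i\<in>{1..d}. {x \<in> carrier (?C i). x [^]\<^bsub>?C i\<^esub> k = 0})"
    by (simp only: set_eq_iff mem_Collect_eq memP) blast
  moreover have "card (\<Pi>\<^sub>E i\<in>{1..d}. {x \<in> carrier (?C i). x [^]\<^bsub>?C i\<^esub> k = 0})
      = (\<Prod>i=1..d. gcd k (n i))"
    using assms(1) unfolding divisor_chain_def
    by (subst card_PiE) (auto intro!: prod.cong card_torsion_integer_mod_group
        simp del: pow_integer_mod_group)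
  ultimately show ?thesis by simp
qed

lemma card_torsion_iso:
  assumes "G \<cong> H" "group G" "group H"
  shows "card {x \<in> carrier G. x [^]\<^bsub>G\<^esub> (k::nat) = \<one>\<^bsub>G\<^esub>}
       = card {x \<in> carrier H. x [^]\<^bsub>H\<^esub> k = \<one>\<^bsub>H\<^esub>}"
proof -
  obtain h where h: "h \<in> hom G H" "bij_betw h (carrier G) (carrier H)"
    using assms(1) unfolding is_iso_def iso_def by auto
  interpret group_hom G H h
    using assms h(1) by (simp add: group_hom_def group_hom_axioms_def)
  have "x [^]\<^bsub>G\<^esub> k = \<one>\<^bsub>G\<^esub> \<longleftrightarrow> h x [^]\<^bsub>H\<^esub> k = \<one>\<^bsub>H\<^esub>" if "x \<in> carrier G" for x
    using that h(2) by (metis G.nat_pow_closed G.one_closed bij_betw_def hom_nat_pow hom_one inj_on_def)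
  moreover have "h ` carrier G = carrier H" "inj_on h (carrier G)"
    using h(2) by (auto simp: bij_betw_def)
  ultimately have "h ` {x \<in> carrier G. x [^]\<^bsub>G\<^esub> k = \<one>\<^bsub>G\<^esub>} = {y \<in> carrier H. y [^]\<^bsub>H\<^esub> k = \<one>\<^bsub>H\<^esub>}"
    by (intro equalityI subsetI) (auto 0 2, smt (verit) imageE imageI mem_Collect_eq)
  with h(2) have "bij_betw h {x \<in> carrier G. x [^]\<^bsub>G\<^esub> k = \<one>\<^bsub>G\<^esub>} {y \<in> carrier H. y [^]\<^bsub>H\<^esub> k = \<one>\<^bsub>H\<^esub>}"
    by (intro bij_betw_subset[OF h(2)]) auto
  then show ?thesis by (rule bij_betw_same_card)
qed

lemma davenport_star_eq:
  assumes "group G" "divisor_chain d n"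
    and "G \<cong> product_group {1..d} (\<lambda>i. integer_mod_group (n i))"
  shows "davenport_star G = 1 + (\<Sum>i=1..d. n i - 1)"
  unfolding davenport_star_def
proof (rule the_equality)
  show "\<exists>d' n'. divisor_chain d' n' \<and>
      G \<cong> product_group {1..d'} (\<lambda>i. integer_mod_group (n' i)) \<and>
      1 + (\<Sum>i=1..d. n i - 1) = 1 + (\<Sum>i=1..d'. n' i - 1)"
    using assms by blast
next
  fix k assume "\<exists>e m. divisor_chain e m \<and>
      G \<cong> product_group {1..e} (\<lambda>i. integer_mod_group (m i)) \<and> k = 1 + (\<Sum>i=1..e. m i - 1)"
  then obtain e m where em: "divisor_chain e m"
    "G \<cong> product_group {1..e} (\<lambda>i. integer_mod_group (m i))" "k = 1 + (\<Sum>i=1..e. m i - 1)"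
    by blast
  have "(\<Prod>i=1..d. gcd k (n i)) = (\<Prod>i=1..e. gcd k (m i))" for k
    using card_torsion_iso[OF assms(3) assms(1), of k] card_torsion_iso[OF em(2) assms(1), of k]
      card_torsion_product_group[OF assms(2), of k] card_torsion_product_group[OF em(1), of k]
    by simp
  with em assms(2) show "k = 1 + (\<Sum>i=1..d. n i - 1)"
    using divisor_chain_sum_unique by metis
qed

end

theory Submission
  imports Defs "HOL-Library.Disjoint_Sets"
begin

text \<open>
  Suppose a family of more than the sum of the \<open>p ^ e c - 1\<close> vectors had no nonempty subfamily whose
  \<open>c\<close>-th coordinates add up to a multiple of \<open>p ^ e c\<close> for all \<open>c\<close>. For a subfamily \<open>J\<close> with
  coordinate sums \<open>s c\<close>, the product of the binomials \<open>(s c + p ^ e c - 1) choose (p ^ e c - 1)\<close>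
  would then be divisible by \<open>p\<close> except at \<open>J = {}\<close>, where it is 1. As a function of \<open>J\<close> it is an
  integer polynomial in the indicators of \<open>i \<in> J\<close> of degree less than the number of vectors, so its
  alternating sum over all \<open>J\<close> vanishes: a contradiction. This is Olson's theorem for \<open>p\<close>-groups.

  Write \<open>q = p * r\<close>. An additional coordinate equal to 1 modulo \<open>p\<^sup>2\<close> turns Olson's theorem for
  \<open>C\<^sub>p\<^sup>d\<^sup>-\<^sup>1 \<times> C\<close> with \<open>C\<close> cyclic of order \<open>p\<^sup>2\<close> into the existence of zero-sum subfamilies of length at
  most \<open>p\<^sup>2\<close>, as soon as \<open>p \<ge> d\<close>. Removing such subfamilies one after another leaves enough terms for
  \<open>r\<close> disjoint ones; their sums lie in a cyclic group of order \<open>r\<close>, where some of them cancel.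
\<close>

section \<open>Integer polynomials in the indicators of \<open>i \<in> J\<close>\<close>

text \<open>\<open>of_bool (S \<subseteq> J)\<close> is the product of the indicators of
  \<open>i \<in> J\<close> over \<open>i \<in> S\<close>. Indicators are idempotent, so multilinear
  monomials suffice; \<open>k\<close> bounds the degree.\<close>

inductive set_poly :: "nat \<Rightarrow> ('i set \<Rightarrow> int) \<Rightarrow> bool" where
  monom: "finite S \<Longrightarrow> card S \<le> k \<Longrightarrow> set_poly k (\<lambda>J. c * of_bool (S \<subseteq> J))"
| add: "set_poly k f \<Longrightarrow> set_poly k g \<Longrightarrow> set_poly k (\<lambda>J. f J + g J)"

lemma set_poly_const: "set_poly k (\<lambda>J. c)"
  using set_poly.monom[of "{}" k c] by simp

lemma set_poly_sum:
  "finite T \<Longrightarrow> (\<And>t. t \<in> T \<Longrightarrow> set_poly k (f t)) \<Longrightarrow> set_poly k (\<lambda>J. \<Sum>t\<in>T. f t J)"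
  by (induction T rule: finite_induct) (auto intro: set_poly_const set_poly.add)

text \<open>The monomials of \<open>S\<close> and \<open>T\<close> multiply to that of
  \<open>S \<union> T\<close>, so degrees add at most.\<close>

lemma set_poly_mult_monom:
  assumes "set_poly l g" "finite S" "card S \<le> k"
  shows "set_poly (k + l) (\<lambda>J. c * of_bool (S \<subseteq> J) * g J)"
  using assms(1)
proof induction
  case (monom T l c')
  have "card (S \<union> T) \<le> k + l"
    using card_Un_le[of S T] assms monom by linarith
  then have "set_poly (k + l) (\<lambda>J. (c * c') * of_bool (S \<union> T \<subseteq> J))"
    using assms monom by (intro set_poly.monom) auto
  then show ?case
    by (rule back_subst[of "set_poly (k + l)"]) (auto simp: fun_eq_iff)
next
  case (add l f g)
  then have "set_poly (k + l) (\<lambda>J. c * of_bool (S \<subseteq> J) * f J + c * of_bool (S \<subseteq> J) * g J)"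
    by (intro set_poly.add)
  then show ?case by (simp add: distrib_left)
qed

lemma set_poly_mult:
  assumes "set_poly k f" "set_poly l g"
  shows "set_poly (k + l) (\<lambda>J. f J * g J)"
  using assms(1)
proof induction
  case (monom S k c)
  then show ?case using set_poly_mult_monom assms(2) by blast
next
  case (add k f f')
  then have "set_poly (k + l) (\<lambda>J. f J * g J + f' J * g J)"
    by (intro set_poly.add)
  then show ?case by (simp add: distrib_right)
qed

lemma set_poly_prod:
  "finite C \<Longrightarrow> (\<And>c. c \<in> C \<Longrightarrow> set_poly (k c) (f c)) \<Longrightarrow>
    set_poly (\<Sum>c\<in>C. k c) (\<lambda>J. \<Prod>c\<in>C. f c J)"
  by (induction C rule: finite_induct) (auto intro: set_poly_const set_poly_mult)

text \<open>The degree is bounded by \<open>k\<close>, however large the weights \<open>a i\<close>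
  are. Vandermonde's identity splits off one index \<open>i\<close>, whose contribution is
  \<open>a i\<close> or 0. For \<open>t > 0\<close> its binomial is \<open>a i choose t\<close>
  times a single indicator, of degree 1, hence at most \<open>t\<close>.\<close>

lemma set_poly_choose_sum:
  fixes a :: "'i \<Rightarrow> nat"
  assumes "finite I"
  shows "set_poly k (\<lambda>J. int (((\<Sum>i\<in>I \<inter> J. a i) + m) choose k))"
  using assms
proof (induction I arbitrary: k rule: finite_induct)
  case empty
  then show ?case by (simp add: set_poly_const)
next
  case (insert i I)
  let ?s = "\<lambda>J. (\<Sum>i\<in>I \<inter> J. a i) + m" and ?x = "\<lambda>J. if i \<in> J then a i else 0"
  have "(\<Sum>j\<in>insert i I \<inter> J. a j) + m = ?x J + ?s J" for J
    using insert.hyps by (auto simp: Int_insert_left)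
  then have eq: "int (((\<Sum>j\<in>insert i I \<inter> J. a j) + m) choose k)
      = (\<Sum>t\<le>k. int (?x J choose t) * int (?s J choose (k - t)))" for J
    by (simp only: vandermonde[symmetric] of_nat_sum of_nat_mult)
  have "set_poly t (\<lambda>J. int (?x J choose t))" for t
  proof (cases t)
    case 0
    then show ?thesis by (simp add: set_poly_const)
  next
    case (Suc u)
    have "set_poly t (\<lambda>J. int (a i choose t) * of_bool ({i} \<subseteq> J))"
      using Suc by (intro set_poly.monom) auto
    then show ?thesis
      by (rule back_subst[of "set_poly t"]) (use Suc in \<open>auto simp: fun_eq_iff\<close>)
  qed
  then have summand: "set_poly (t + (k - t)) (\<lambda>J. int (?x J choose t) * int (?s J choose (k - t)))" for t
    by (intro set_poly_mult insert.IH)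
  have "set_poly k (\<lambda>J. int (?x J choose t) * int (?s J choose (k - t)))" if "t \<le> k" for t
    using summand[of t] that by (simp only: le_add_diff_inverse)
  then show ?case unfolding eq by (intro set_poly_sum) auto
qed

lemma sum_Pow_remove:
  fixes f :: "'i set \<Rightarrow> int"
  assumes "finite I" "x \<in> I"
  shows "(\<Sum>J\<in>Pow I. f J) = (\<Sum>J\<in>Pow (I - {x}). f J + f (insert x J))"
proof -
  have "Pow I = Pow (I - {x}) \<union> insert x ` Pow (I - {x})"
    using assms Pow_insert[of x "I - {x}"] by (simp add: insert_absorb)
  moreover have "inj_on (insert x) (Pow (I - {x}))"
    by (auto simp: inj_on_def)
  ultimately show ?thesis
    using assms by (subst \<open>Pow I = _\<close>, subst sum.union_disjoint)
      (auto simp: sum.reindex sum.distrib)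
qed

text \<open>A monomial of degree below \<open>card I\<close> misses some \<open>x \<in> I\<close>.
  Its values at \<open>J\<close> and \<open>insert x J\<close> agree while the signs differ, so the
  subsets cancel in pairs.\<close>

lemma set_poly_alternating_sum:
  assumes "set_poly k f" "finite I" "k < card I"
  shows "(\<Sum>J\<in>Pow I. (-1) ^ card J * f J) = 0"
  using assms(1,3)
proof induction
  case (monom S k c)
  obtain x where x: "x \<in> I" "x \<notin> S"
    using monom card_mono[of S I] by (metis leD le_less_trans subsetI)
  have "(-1) ^ card J * (c * of_bool (S \<subseteq> J)) +
      (-1) ^ card (insert x J) * (c * of_bool (S \<subseteq> insert x J)) = 0"
    if "J \<in> Pow (I - {x})" for J
  proof -
    have "finite J" "x \<notin> J" using that assms(2) by (auto intro: finite_subset)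
    moreover have "S \<subseteq> insert x J \<longleftrightarrow> S \<subseteq> J" using x by blast
    ultimately show ?thesis by simp
  qed
  then show ?case
    by (simp add: sum_Pow_remove[OF assms(2) x(1)])
next
  case (add k f g)
  then show ?case by (simp add: distrib_left sum.distrib)
qed

section \<open>Olson's theorem for \<open>p\<close>-groups\<close>

text \<open>Otherwise the binomial is coprime to \<open>p ^ e\<close>, and the absorption identity
  \<open>q * ((s + q) choose q) = (s + q) * ((s + q - 1) choose (q - 1))\<close> with
  \<open>q = p ^ e\<close> forces \<open>q\<close> to divide \<open>s + q\<close>, hence
  \<open>s\<close>.\<close>

lemma prime_dvd_choose_pred_prime_power:
  fixes p s :: nat
  assumes "prime p" "\<not> p ^ e dvd s"
  shows "p dvd (s + (p ^ e - 1)) choose (p ^ e - 1)"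
proof (rule ccontr)
  let ?q = "p ^ e"
  assume "\<not> p dvd (s + (?q - 1)) choose (?q - 1)"
  then have "coprime ?q ((s + (?q - 1)) choose (?q - 1))"
    using assms(1) by (simp add: prime_imp_coprime)
  moreover have q: "?q > 0" using assms(1) by (simp add: prime_gt_0_nat)
  then have "s + ?q - 1 = s + (?q - 1)" by linarith
  then have "?q * ((s + ?q) choose ?q) = (s + ?q) * ((s + (?q - 1)) choose (?q - 1))"
    using times_binomial_minus1_eq[OF q, of "s + ?q"] by argo
  then have "?q dvd (s + ?q) * ((s + (?q - 1)) choose (?q - 1))"
    by (metis dvd_triv_left)
  ultimately have "?q dvd s + ?q" by (simp add: coprime_dvd_mult_left_iff)
  with assms(2) show False by simp
qed

theorem olson_nat:
  fixes a :: "'c \<Rightarrow> 'i \<Rightarrow> nat"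
  assumes "prime p" "finite C" "finite I" "(\<Sum>c\<in>C. p ^ e c - 1) < card I"
  obtains J where "J \<subseteq> I" "J \<noteq> {}" "\<And>c. c \<in> C \<Longrightarrow> p ^ e c dvd (\<Sum>i\<in>J. a c i)"
proof (rule ccontr)
  note zero_sumI = that
  assume contra: "\<not> thesis"
  define F where "F J = (\<Prod>c\<in>C. int (((\<Sum>i\<in>I \<inter> J. a c i) + (p ^ e c - 1)) choose (p ^ e c - 1)))" for J
  have "set_poly (\<Sum>c\<in>C. p ^ e c - 1) F"
    unfolding F_def using assms by (intro set_poly_prod set_poly_choose_sum)
  then have "(\<Sum>J\<in>Pow I. (-1) ^ card J * F J) = 0"
    using assms by (intro set_poly_alternating_sum)
  moreover have "(\<Sum>J\<in>Pow I. (-1) ^ card J * F J)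
      = F {} + (\<Sum>J\<in>Pow I - {{}}. (-1) ^ card J * F J)"
    using assms(3) by (subst sum.remove[of _ "{}"]) auto
  \<comment> \<open>With an empty sum every factor has the form \<open>n choose n\<close>.\<close>
  moreover have "F {} = 1" by (simp add: F_def)
  moreover have "int p dvd (\<Sum>J\<in>Pow I - {{}}. (-1) ^ card J * F J)"
  proof (intro dvd_sum dvd_mult)
    fix J assume J: "J \<in> Pow I - {{}}"
    then obtain c where c: "c \<in> C" "\<not> p ^ e c dvd (\<Sum>i\<in>J. a c i)"
      using contra zero_sumI[of J] by blast
    have "I \<inter> J = J" using J by blast
    then have "int p dvd int (((\<Sum>i\<in>I \<inter> J. a c i) + (p ^ e c - 1)) choose (p ^ e c - 1))"
      using prime_dvd_choose_pred_prime_power[OF assms(1) c(2)] by simp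
    then show "int p dvd F J"
      unfolding F_def using assms(2) c(1) by (rule dvd_trans[OF _ dvd_prodI])
  qed
  ultimately have "int p dvd 1"
    by (metis dvd_0_right dvd_add_left_iff)
  then show False using assms(1) by (simp add: prime_nat_iff)
qed

text \<open>Replacing each entry by its residue reduces integers to the natural numbers that
  binomials require.\<close>

theorem olson:
  fixes a :: "'c \<Rightarrow> 'i \<Rightarrow> int"
  assumes "prime p" "finite C" "finite I" "(\<Sum>c\<in>C. p ^ e c - 1) < card I"
  obtains J where "J \<subseteq> I" "J \<noteq> {}" "\<And>c. c \<in> C \<Longrightarrow> int (p ^ e c) dvd (\<Sum>i\<in>J. a c i)"
proof -
  obtain J where J: "J \<subseteq> I" "J \<noteq> {}"
    "\<And>c. c \<in> C \<Longrightarrow> p ^ e c dvd (\<Sum>i\<in>J. nat (a c i mod int (p ^ e c)))"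
    by (rule olson_nat[OF assms, of "\<lambda>c i. nat (a c i mod int (p ^ e c))"]) blast
  have "int (p ^ e c) dvd (\<Sum>i\<in>J. a c i)" if "c \<in> C" for c
  proof -
    have "p ^ e c > 0" using assms(1) by (simp add: prime_gt_0_nat)
    then have "int (\<Sum>i\<in>J. nat (a c i mod int (p ^ e c))) = (\<Sum>i\<in>J. a c i mod int (p ^ e c))"
      unfolding of_nat_sum by (intro sum.cong refl nat_0_le pos_mod_sign) linarith
    moreover have "int (p ^ e c) dvd int (\<Sum>i\<in>J. nat (a c i mod int (p ^ e c)))"
      using J(3)[OF that] by (simp only: int_dvd_int_iff)
    ultimately have "int (p ^ e c) dvd (\<Sum>i\<in>J. a c i mod int (p ^ e c))" by simp
    then show ?thesis by (simp only: dvd_eq_mod_eq_0 mod_sum_eq)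
  qed
  with J that show thesis by blast
qed

section \<open>Short and disjoint zero-sum subfamilies\<close>

text \<open>With \<open>n = p ^ E\<close>, an extra coordinate constantly 1 makes
  \<open>card J\<close> a multiple of \<open>n\<close>, and \<open>small\<close> keeps it below
  \<open>3 * n\<close>. If it is \<open>2 * n\<close>, then \<open>J\<close> splits into two
  nonempty zero-sum parts, one of which has at most \<open>n\<close> elements.\<close>

lemma short_zero_sum:
  fixes a :: "'c \<Rightarrow> 'i \<Rightarrow> int"
  assumes p: "prime p" and fin: "finite C" "finite I"
    and small: "(\<Sum>c\<in>C. p ^ e c - 1) + 2 \<le> 2 * p ^ E"
    and card: "(\<Sum>c\<in>C. p ^ e c - 1) + p ^ E \<le> card I"
  obtains J where "J \<subseteq> I" "J \<noteq> {}" "card J \<le> p ^ E"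
    "\<And>c. c \<in> C \<Longrightarrow> int (p ^ e c) dvd (\<Sum>i\<in>J. a c i)"
proof -
  define M n where "M = (\<Sum>c\<in>C. p ^ e c - 1)" and "n = p ^ E"
  have n: "n > 0" using p by (simp add: n_def prime_gt_0_nat)
  \<comment> \<open>Exactly \<open>M + n\<close> indices: enough for Olson's theorem with the extra
    coordinate, and few enough to bound \<open>card J\<close>.\<close>
  obtain I' where I': "I' \<subseteq> I" "card I' = M + n"
    using card obtain_subset_with_card_n unfolding M_def n_def by metis
  have finI': "finite I'" using I' fin finite_subset by blast
  \<comment> \<open>\<open>None\<close> names the extra coordinate.\<close>
  let ?C = "insert None (Some ` C)" and ?e = "case_option E e" and ?a = "case_option (\<lambda>_. 1) a"
  have "(\<Sum>c\<in>?C. p ^ ?e c - 1) = (n - 1) + M"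
    using fin by (simp add: sum.reindex M_def n_def)
  then have "(\<Sum>c\<in>?C. p ^ ?e c - 1) < card I'" using I' n by simp
  then obtain J where J: "J \<subseteq> I'" "J \<noteq> {}"
    "\<And>c. c \<in> ?C \<Longrightarrow> int (p ^ ?e c) dvd (\<Sum>i\<in>J. ?a c i)"
    using olson[of p ?C I' ?e ?a] p fin finI' by blast
  have Jz: "int (p ^ e c) dvd (\<Sum>i\<in>J. a c i)" if "c \<in> C" for c
    using J(3)[of "Some c"] that by simp
  have "n dvd card J" using J(3)[of None] by (simp add: n_def flip: of_nat_power)
  have finJ: "finite J" using J finI' finite_subset by blast
  show thesis
  proof (cases "card J \<le> n")
    case True
    then show ?thesis using that[of J] J Jz I' n_def by auto
  next
    case False
    have "card J \<le> M + n" using J I' finI' card_mono by metis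
    with small have "card J < n * 3" "n * 1 < card J" using False by (auto simp: M_def n_def)
    with \<open>n dvd card J\<close> have J2: "card J = 2 * n"
      by (elim dvdE) (auto simp del: mult_1_right)
    \<comment> \<open>Leaving out \<open>x\<close> makes \<open>K\<close> a proper subset of
      \<open>J\<close>, so \<open>J - K\<close> is nonempty. The remaining \<open>2 * n - 1\<close>
      indices still exceed \<open>M\<close>.\<close>
    obtain x where x: "x \<in> J" using J by blast
    have "M < card (J - {x})"
      using J2 small x finJ by (simp add: M_def n_def)
    then obtain K where K: "K \<subseteq> J - {x}" "K \<noteq> {}"
      "\<And>c. c \<in> C \<Longrightarrow> int (p ^ e c) dvd (\<Sum>i\<in>K. a c i)"
      using olson[of p C "J - {x}" e a] p fin finJ unfolding M_def by blast
    have sub: "K \<subseteq> J" using K by blast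
    show ?thesis
    proof (cases "card K \<le> n")
      case True
      then show ?thesis using that[of K] J K I' n_def by blast
    next
      case False
      then have "card (J - K) \<le> n"
        using J2 sub finJ by (simp add: card_Diff_subset finite_subset)
      moreover have "int (p ^ e c) dvd (\<Sum>i\<in>J - K. a c i)" if "c \<in> C" for c
        using Jz[OF that] K(3)[OF that] sub finJ by (simp add: sum_diff)
      moreover have "J - K \<noteq> {}" "J - K \<subseteq> I" using K x J I' by blast+
      ultimately show ?thesis using that[of "J - K"] n_def by blast
    qed
  qed
qed

text \<open>Each of the first \<open>r\<close> extractions uses up at most \<open>p ^ E\<close>
  indices; the last one needs only the \<open>M + 1\<close> indices of Olson's theorem, where
  \<open>M\<close> is the sum of the \<open>p ^ e c - 1\<close>.\<close>

lemma disjoint_zero_sums: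
  fixes a :: "'c \<Rightarrow> 'i \<Rightarrow> int"
  assumes p: "prime p" and fin: "finite C" "finite I"
    and small: "(\<Sum>c\<in>C. p ^ e c - 1) + 2 \<le> 2 * p ^ E"
    and card: "(\<Sum>c\<in>C. p ^ e c - 1) + 1 + r * p ^ E \<le> card I"
  shows "\<exists>\<J>. finite \<J> \<and> card \<J> = Suc r \<and> disjoint \<J> \<and>
    (\<forall>J\<in>\<J>. J \<subseteq> I \<and> J \<noteq> {} \<and> (\<forall>c\<in>C. int (p ^ e c) dvd (\<Sum>i\<in>J. a c i)))"
  using fin(2) card
proof (induction r arbitrary: I)
  case 0
  then obtain J where "J \<subseteq> I" "J \<noteq> {}" "\<And>c. c \<in> C \<Longrightarrow> int (p ^ e c) dvd (\<Sum>i\<in>J. a c i)"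
    using olson[of p C I e a] p fin by auto
  then show ?case by (intro exI[of _ "{J}"]) (auto simp: disjoint_def)
next
  case (Suc r)
  then obtain J where J: "J \<subseteq> I" "J \<noteq> {}" "card J \<le> p ^ E"
    "\<And>c. c \<in> C \<Longrightarrow> int (p ^ e c) dvd (\<Sum>i\<in>J. a c i)"
    using short_zero_sum[of p C I e E a] p fin small by auto
  have "finite J" using J Suc.prems finite_subset by blast
  then have "card (I - J) = card I - card J" using J by (simp add: card_Diff_subset)
  then have "(\<Sum>c\<in>C. p ^ e c - 1) + 1 + r * p ^ E \<le> card (I - J)"
    using Suc.prems J(3) by simp
  then obtain \<J> where \<J>: "finite \<J>" "card \<J> = Suc r" "disjoint \<J>"
    "\<forall>J'\<in>\<J>. J' \<subseteq> I - J \<and> J' \<noteq> {} \<and> (\<forall>c\<in>C. int (p ^ e c) dvd (\<Sum>i\<in>J'. a c i))"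
    using Suc.IH[of "I - J"] Suc.prems by auto
  have "J \<inter> K = {}" if "K \<in> \<J>" for K using \<J>(4) that by auto
  then have "disjoint (insert J \<J>)"
    using \<J>(3) by (simp add: pairwise_insert disjnt_def Int_commute)
  \<comment> \<open>Members of the family lie in \<open>I - J\<close>, and \<open>J\<close> is
    nonempty; so the cardinality really grows.\<close>
  moreover have "J \<notin> \<J>" using \<J>(4) J(2) by auto
  ultimately show ?case
    using \<J> J by (intro exI[of _ "insert J \<J>"]) auto
qed

section \<open>From \<open>p\<close>-groups to the modulus \<open>p * (p * r)\<close>\<close>

text \<open>Pigeonhole: two of the \<open>r + 1\<close> partial sums, the empty one included, agree
  modulo \<open>r\<close>, and the block between them sums to 0.\<close>

lemma zero_sum_subset_mod:
  fixes f :: "'b \<Rightarrow> int"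
  assumes "card A = r" "r > 0"
  obtains B where "B \<subseteq> A" "B \<noteq> {}" "int r dvd sum f B"
proof -
  obtain h where h: "bij_betw h {..<r} A"
    using assms ex_bij_betw_nat_finite[of A] by (metis atLeast0LessThan card.infinite less_irrefl)
  define s where "s k = (\<Sum>i<k. f (h i)) mod int r" for k
  have "s ` {..r} \<subseteq> {0..<int r}" using assms by (auto simp: s_def)
  from card_mono[OF finite_atLeastLessThan_int this] have "card (s ` {..r}) \<le> r" by simp
  then have "\<not> inj_on s {..r}" using card_image[of s "{..r}"] by auto
  then obtain i' j' where "i' \<noteq> j'" "i' \<le> r" "j' \<le> r" "s i' = s j'"
    unfolding inj_on_def by auto
  then obtain i j where ij: "i < j" "j \<le> r" "s i = s j"
    by (cases i' j' rule: linorder_cases) auto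
  have "int r dvd (\<Sum>k<j. f (h k)) - (\<Sum>k<i. f (h k))"
    using ij(3) unfolding s_def by (metis mod_eq_dvd_iff)
  also have "(\<Sum>k<j. f (h k)) - (\<Sum>k<i. f (h k)) = (\<Sum>k\<in>{i..<j}. f (h k))"
    using sum_diff_nat_ivl[of 0 i j "\<lambda>k. f (h k)"] ij(1) by (simp add: atLeast0LessThan)
  also have "\<dots> = sum f (h ` {i..<j})"
    using h ij(2) by (subst sum.reindex) (auto simp: bij_betw_def inj_on_def)
  finally have "int r dvd sum f (h ` {i..<j})" .
  moreover have "h ` {i..<j} \<subseteq> A" "h ` {i..<j} \<noteq> {}" using h ij by (auto simp: bij_betw_def)
  ultimately show thesis using that by blast
qed

lemma zero_sum_index_set:
  fixes a :: "nat \<Rightarrow> 'i \<Rightarrow> int"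
  assumes p: "prime p" "d \<le> p" and "d > 0" "r > 0" and fin: "finite I"
    and card: "card I \<ge> p * (p * r) + (d - 1) * (p - 1)"
  obtains J where "J \<subseteq> I" "J \<noteq> {}" "int (p * (p * r)) dvd (\<Sum>i\<in>J. a 0 i)"
    "\<And>j. j \<in> {1..<d} \<Longrightarrow> int p dvd (\<Sum>i\<in>J. a j i)"
proof -
  \<comment> \<open>Coordinate 0 is first treated modulo \<open>p\<^sup>2\<close> only; the factor
    \<open>r\<close> is recovered afterwards.\<close>
  define e :: "nat \<Rightarrow> nat" where "e j = (if j = 0 then 2 else 1)" for j
  have p0: "p > 0" using p by (simp add: prime_gt_0_nat)
  have "{..<d} = insert 0 {1..<d}" using \<open>d > 0\<close> by auto
  then have M: "(\<Sum>j<d. p ^ e j - 1) = (p\<^sup>2 - 1) + (d - 1) * (p - 1)"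
    by (simp add: e_def)
  \<comment> \<open>This is where \<open>d \<le> p\<close> enters: it yields the hypothesis
    \<open>small\<close> of the extraction lemmas.\<close>
  have "(d - 1) * (p - 1) + 1 \<le> p * p"
  proof -
    have "(d - 1) * (p - 1) \<le> (p - 1) * p" using p by (intro mult_mono) auto
    also have "(p - 1) * p + 1 \<le> p * p" using p0 by (cases p) auto
    finally show ?thesis by simp
  qed
  then have small: "(\<Sum>j<d. p ^ e j - 1) + 2 \<le> 2 * p ^ 2"
    unfolding M using p0 by (simp add: power2_eq_square)
  have "r * p\<^sup>2 = (r - 1) * p\<^sup>2 + p\<^sup>2" using \<open>r > 0\<close> by (cases r) auto
  \<comment> \<open>The left side equals the assumed lower bound on \<open>card I\<close>, so
    \<open>r\<close> disjoint subfamilies are available with no index to spare.\<close>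
  then have "(\<Sum>j<d. p ^ e j - 1) + 1 + (r - 1) * p ^ 2 \<le> card I"
    unfolding M using p0 card by (simp add: power2_eq_square mult_ac)
  then obtain \<J> where \<J>: "finite \<J>" "card \<J> = r" "disjoint \<J>"
    "\<And>J. J \<in> \<J> \<Longrightarrow> J \<subseteq> I \<and> J \<noteq> {} \<and> (\<forall>j\<in>{..<d}. int (p ^ e j) dvd (\<Sum>i\<in>J. a j i))"
    using disjoint_zero_sums[OF p(1) _ fin small, of "r - 1" a] \<open>r > 0\<close> by auto
  \<comment> \<open>After division by \<open>p\<^sup>2\<close> the sums in coordinate 0 are
    arbitrary integers, and \<open>r\<close> of them contain a zero sum modulo
    \<open>r\<close>.\<close>
  obtain \<B> where \<B>: "\<B> \<subseteq> \<J>" "\<B> \<noteq> {}" "int r dvd (\<Sum>J\<in>\<B>. (\<Sum>i\<in>J. a 0 i) div int (p\<^sup>2))"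
    using zero_sum_subset_mod[OF \<J>(2) \<open>r > 0\<close>] by blast
  have un: "(\<Sum>i\<in>\<Union>\<B>. a j i) = (\<Sum>J\<in>\<B>. \<Sum>i\<in>J. a j i)" for j
  proof -
    have "\<forall>A\<in>\<B>. finite A" using \<J>(4) \<B>(1) fin by (meson finite_subset subsetD)
    moreover have "\<forall>A\<in>\<B>. \<forall>B\<in>\<B>. A \<noteq> B \<longrightarrow> A \<inter> B = {}"
      using \<J>(3) \<B>(1) unfolding disjoint_def by blast
    ultimately show ?thesis by (subst sum.Union_disjoint) auto
  qed
  show thesis
  proof (rule that[of "\<Union>\<B>"])
    show "\<Union>\<B> \<subseteq> I" "\<Union>\<B> \<noteq> {}" using \<J>(4) \<B> by blast+
    show "int p dvd (\<Sum>i\<in>\<Union>\<B>. a j i)" if "j \<in> {1..<d}" for j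
      unfolding un
    proof (rule dvd_sum)
      fix J assume "J \<in> \<B>"
      then have "int (p ^ e j) dvd (\<Sum>i\<in>J. a j i)"
        using \<J>(4)[of J] \<B>(1) that by auto
      then show "int p dvd (\<Sum>i\<in>J. a j i)" using that by (simp add: e_def)
    qed
    have "int (p\<^sup>2) dvd (\<Sum>i\<in>J. a 0 i)" if "J \<in> \<B>" for J
      using \<J>(4)[of J] \<B>(1) that \<open>d > 0\<close> by (force simp: e_def)
    then have "(\<Sum>i\<in>\<Union>\<B>. a 0 i) = int (p\<^sup>2) * (\<Sum>J\<in>\<B>. (\<Sum>i\<in>J. a 0 i) div int (p\<^sup>2))"
      unfolding un sum_distrib_left by (intro sum.cong) auto
    moreover have "int (p\<^sup>2) * int r dvd int (p\<^sup>2) * (\<Sum>J\<in>\<B>. (\<Sum>i\<in>J. a 0 i) div int (p\<^sup>2))"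
      using \<B>(3) by (intro mult_dvd_mono) auto
    ultimately show "int (p * (p * r)) dvd (\<Sum>i\<in>\<Union>\<B>. a 0 i)"
      by (simp add: power2_eq_square mult.assoc)
  qed
qed

section \<open>Sequence sums in coordinates and the upper bound\<close>

text \<open>Elements outside the support have exponent 0. This lets \<open>T\<close> and
  \<open>add_mset x T\<close> be compared over one index set.\<close>

lemma (in comm_monoid) sequence_sum_superset:
  assumes "finite A" "A \<subseteq> carrier G" "set_mset T \<subseteq> A"
  shows "sequence_sum G T = finprod G (\<lambda>x. x [^] count T x) A"
  unfolding sequence_sum_def using assms
  by (intro finprod_mono_neutral_cong_left) (auto simp: not_in_iff)

lemma (in comm_monoid) sequence_sum_add_mset:
  assumes "x \<in> carrier G" "set_mset T \<subseteq> carrier G"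
  shows "sequence_sum G (add_mset x T) = x \<otimes> sequence_sum G T"
proof -
  let ?A = "insert x (set_mset T)"
  have A: "finite ?A" "?A \<subseteq> carrier G" using assms by auto
  have "sequence_sum G (add_mset x T) = finprod G (\<lambda>y. y [^] count (add_mset x T) y) ?A"
    using A by (intro sequence_sum_superset) auto
  also have "\<dots> = finprod G (\<lambda>y. (if x = y then y else \<one>) \<otimes> y [^] count T y) ?A"
    using A by (intro finprod_cong') (auto simp: m_comm)
  also have "\<dots> = finprod G (\<lambda>y. if x = y then y else \<one>) ?A \<otimes> finprod G (\<lambda>y. y [^] count T y) ?A"
    using A by (intro finprod_multf) auto
  also have "finprod G (\<lambda>y. if x = y then y else \<one>) ?A = x"
    using A by (intro finprod_singleton) auto
  also have "finprod G (\<lambda>y. y [^] count T y) ?A = sequence_sum G T"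
    using A by (intro sequence_sum_superset[symmetric]) auto
  finally show ?thesis .
qed

abbreviation cyclic_product :: "nat set \<Rightarrow> nat \<Rightarrow> nat \<Rightarrow> ((nat \<Rightarrow> int) \<times> int) monoid" where
  "cyclic_product I m n \<equiv> product_group I (\<lambda>_. integer_mod_group m) \<times>\<times> integer_mod_group n"

lemma group_cyclic_product: "group (cyclic_product I m n)"
  by (intro DirProd_group) auto

lemma comm_group_cyclic_product: "comm_group (cyclic_product I m n)"
proof (rule group.group_comm_groupI[OF group_cyclic_product])
  fix x y
  show "x \<otimes>\<^bsub>cyclic_product I m n\<^esub> y = y \<otimes>\<^bsub>cyclic_product I m n\<^esub> x"
    by (simp add: mult_DirProd' add.commute)
qed

lemma sequence_sum_cyclic_product:
  assumes "m > 0" "n > 0" "sequence_over (cyclic_product I m n) T"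
  shows "sequence_sum (cyclic_product I m n) T =
    (\<lambda>j\<in>I. (\<Sum>x\<in>#T. fst x j) mod int m, (\<Sum>x\<in>#T. snd x) mod int n)"
  using assms(3)
proof (induction T)
  case empty
  interpret comm_group "cyclic_product I m n" by (rule comm_group_cyclic_product)
  show ?case unfolding sequence_sum_def set_mset_empty finprod_empty by (simp add: fun_eq_iff)
next
  case (add x T)
  interpret comm_group "cyclic_product I m n" by (rule comm_group_cyclic_product)
  have "sequence_sum (cyclic_product I m n) (add_mset x T)
      = x \<otimes>\<^bsub>cyclic_product I m n\<^esub> sequence_sum (cyclic_product I m n) T"
    using add.prems by (intro sequence_sum_add_mset) (auto simp: sequence_over_def)
  also have "\<dots> = (\<lambda>j\<in>I. (\<Sum>x\<in>#add_mset x T. fst x j) mod int m, (\<Sum>x\<in>#add_mset x T. snd x) mod int n)"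
    using add by (simp add: sequence_over_def mult_DirProd' mod_simps fun_eq_iff)
  finally show ?case .
qed

text \<open>The bridge from the group to the divisibility conditions on integer sums used
  above.\<close>

lemma zero_sum_cyclic_product_iff:
  assumes "m > 0" "n > 0" "sequence_over (cyclic_product I m n) T"
  shows "zero_sum (cyclic_product I m n) T \<longleftrightarrow>
    (\<forall>j\<in>I. int m dvd (\<Sum>x\<in>#T. fst x j)) \<and> int n dvd (\<Sum>x\<in>#T. snd x)"
  unfolding zero_sum_def sequence_sum_cyclic_product[OF assms]
  by (auto simp: fun_eq_iff dvd_eq_mod_eq_0)

lemma zero_sum_subsequence_exists:
  assumes p: "prime p" "d \<le> p" and "d > 0" "r > 0"
    and S: "sequence_over (cyclic_product {1..d - 1} p (p * (p * r))) S"
    and size: "size S \<ge> p * (p * r) + (d - 1) * (p - 1)"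
  shows "\<exists>T. T \<subseteq># S \<and> T \<noteq> {#} \<and> zero_sum (cyclic_product {1..d - 1} p (p * (p * r))) T"
proof -
  \<comment> \<open>Positions in a list serve as indices, so that repeated terms become
    distinct.\<close>
  obtain xs where xs: "S = mset xs" by (metis ex_mset)
  \<comment> \<open>Index 0, which is outside \<open>{1..d - 1}\<close>, is free to denote the large
    cyclic factor.\<close>
  define a where "a j i = (if j = 0 then snd (xs ! i) else fst (xs ! i) j)" for j i
  obtain J where J: "J \<subseteq> {..<length xs}" "J \<noteq> {}"
    "int (p * (p * r)) dvd (\<Sum>i\<in>J. a 0 i)"
    "\<And>j. j \<in> {1..<d} \<Longrightarrow> int p dvd (\<Sum>i\<in>J. a j i)"
    using zero_sum_index_set[OF assms(1-4), of "{..<length xs}" a] size xs by auto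
  define T where "T = image_mset (nth xs) (mset_set J)"
  have finJ: "finite J" using J finite_subset by blast
  have "S = image_mset (nth xs) (mset_set {..<length xs})"
    by (metis atLeast0LessThan map_nth mset_map mset_upt xs)
  then have sub: "T \<subseteq># S"
    unfolding T_def using J by (simp add: image_mset_subseteq_mono subset_imp_msubset_mset_set)
  then have "sequence_over (cyclic_product {1..d - 1} p (p * (p * r))) T"
    using S set_mset_mono unfolding sequence_over_def by blast
  moreover have "(\<Sum>x\<in>#T. snd x) = (\<Sum>i\<in>J. a 0 i)"
    by (simp add: T_def a_def image_mset.compositionality comp_def sum_unfold_sum_mset)
  moreover have "(\<Sum>x\<in>#T. fst x j) = (\<Sum>i\<in>J. a j i)" if "j \<in> {1..d - 1}" for j
    using that by (simp add: T_def a_def image_mset.compositionality comp_def sum_unfold_sum_mset)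
  moreover have "{1..<d} = {1..d - 1}" using \<open>d > 0\<close> by auto
  moreover have "p > 0" using p by (simp add: prime_gt_0_nat)
  ultimately have "zero_sum (cyclic_product {1..d - 1} p (p * (p * r))) T"
    using J(3,4) \<open>r > 0\<close> by (subst zero_sum_cyclic_product_iff) auto
  moreover have "T \<noteq> {#}" using J finJ by (simp add: T_def mset_set_empty_iff)
  ultimately show ?thesis using sub by blast
qed

section \<open>The lower bound\<close>

lemma sum_mset_mono_subseteq:
  fixes f :: "'b \<Rightarrow> int"
  assumes "T \<subseteq># S" "\<And>x. x \<in># S \<Longrightarrow> f x \<ge> 0"
  shows "0 \<le> (\<Sum>x\<in>#T. f x)" "(\<Sum>x\<in>#T. f x) \<le> (\<Sum>x\<in>#S. f x)"
proof -
  obtain U where U: "S = T + U" using assms(1) mset_subset_eq_exists_conv by metis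
  have "(\<Sum>x\<in>#V. f x) \<ge> 0" if "set_mset V \<subseteq> set_mset S" for V
    using that assms(2) by (induction V) auto
  then show "0 \<le> (\<Sum>x\<in>#T. f x)" "(\<Sum>x\<in>#T. f x) \<le> (\<Sum>x\<in>#S. f x)"
    using U by auto
qed

text \<open>The standard extremal sequence: \<open>n - 1\<close> copies of the generator
  \<open>v\<close> of the large factor and \<open>m - 1\<close> copies of each generator
  \<open>u i\<close>. Coordinate sums of a subsequence stay below the moduli, so divisibility makes
  them 0.\<close>

lemma zero_sum_free_sequence:
  assumes "m > 1" "n > 1" "finite I"
  obtains S where "sequence_over (cyclic_product I m n) S" "size S = (n - 1) + card I * (m - 1)"
    "\<And>T. T \<subseteq># S \<Longrightarrow> zero_sum (cyclic_product I m n) T \<Longrightarrow> T = {#}"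
proof -
  define u :: "nat \<Rightarrow> (nat \<Rightarrow> int) \<times> int" where "u i = (\<lambda>j\<in>I. of_bool (j = i), 0)" for i
  define v :: "(nat \<Rightarrow> int) \<times> int" where "v = (\<lambda>j\<in>I. 0, 1)"
  define S where "S = replicate_mset (n - 1) v + (\<Sum>i\<in>I. replicate_mset (m - 1) (u i))"
  have set_S: "set_mset S \<subseteq> insert v (u ` I)"
    using assms(3) unfolding S_def by (auto simp: set_mset_sum split: if_splits)
  have carrier: "insert v (u ` I) \<subseteq> carrier (cyclic_product I m n)"
    using assms by (auto simp: u_def v_def carrier_integer_mod_group)
  have over: "sequence_over (cyclic_product I m n) S"
    using set_S carrier unfolding sequence_over_def by blast
  have sum_S: "(\<Sum>x\<in>#S. f x) = int (n - 1) * f v + (\<Sum>i\<in>I. int (m - 1) * f (u i))"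
    for f :: "_ \<Rightarrow> int"
  proof -
    have "(\<Sum>x\<in>#(\<Sum>i\<in>I. replicate_mset (m - 1) (u i)). f x) = (\<Sum>i\<in>I. int (m - 1) * f (u i))"
      using assms(3) by (induction I rule: finite_induct) auto
    then show ?thesis by (simp add: S_def)
  qed
  have size_S: "size S = (n - 1) + card I * (m - 1)"
    by (simp add: S_def size_multiset_sum)
  have "T = {#}" if T: "T \<subseteq># S" "zero_sum (cyclic_product I m n) T" for T
  proof -
    have "sequence_over (cyclic_product I m n) T"
      using over T(1) set_mset_mono unfolding sequence_over_def by blast
    then have dvd: "\<forall>j\<in>I. int m dvd (\<Sum>x\<in>#T. fst x j)" "int n dvd (\<Sum>x\<in>#T. snd x)"
      using T(2) assms zero_sum_cyclic_product_iff[of m n I T] by auto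
    have nonneg: "snd x \<ge> 0" "j \<in> I \<Longrightarrow> fst x j \<ge> 0" if "x \<in># S" for x j
      using that set_S by (auto simp: u_def v_def)
    have "(\<Sum>x\<in>#S. snd x) = int (n - 1)" by (simp add: sum_S u_def v_def)
    then have "(\<Sum>x\<in>#T. snd x) < int n" "0 \<le> (\<Sum>x\<in>#T. snd x)"
      using sum_mset_mono_subseteq[OF T(1), of snd] nonneg assms(2) by auto
    then have z0: "(\<Sum>x\<in>#T. snd x) = 0" using dvd(2) zdvd_imp_le by fastforce
    have zj: "(\<Sum>x\<in>#T. fst x j) = 0" if "j \<in> I" for j
    proof -
      have "(\<Sum>x\<in>#S. fst x j) = int (m - 1)"
        using that assms(3) by (simp add: sum_S u_def v_def if_distrib flip: sum_distrib_left)
      then have "(\<Sum>x\<in>#T. fst x j) < int m" "0 \<le> (\<Sum>x\<in>#T. fst x j)"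
        using sum_mset_mono_subseteq[OF T(1), of "\<lambda>x. fst x j"] nonneg that assms(1) by auto
      then show ?thesis using dvd(1) that zdvd_imp_le by fastforce
    qed
    \<comment> \<open>Every term is a unit vector, so the coordinate sums of \<open>T\<close> add up
      to its length.\<close>
    have "snd x + (\<Sum>j\<in>I. fst x j) = 1" if "x \<in># T" for x
      using that T(1) set_S assms(3) mset_subset_eqD by (fastforce simp: u_def v_def)
    then have "int (size T) = (\<Sum>x\<in>#T. snd x + (\<Sum>j\<in>I. fst x j))"
      by (simp cong: image_mset_cong)
    also have "\<dots> = (\<Sum>x\<in>#T. snd x) + (\<Sum>j\<in>I. \<Sum>x\<in>#T. fst x j)"
      by (induction T) (auto simp: sum.distrib)
    also have "\<dots> = 0" using z0 zj by simp
    finally show "T = {#}" by simp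
  qed
  with over size_S that show thesis by blast
qed

section \<open>Both invariants of the group\<close>

lemma davenport_cyclic_product:
  assumes p: "prime p" "d \<le> p" and "d > 0" "r > 0"
  shows "davenport (cyclic_product {1..d - 1} p (p * (p * r))) = p * (p * r) + (d - 1) * (p - 1)"
  unfolding davenport_def
proof (rule Least_equality)
  have p1: "p > 1" using p(1) by (rule prime_gt_1_nat)
  then have "p * 1 \<le> p * (p * r)" using \<open>r > 0\<close> by (intro mult_le_mono2) (simp add: Suc_le_eq)
  then have n: "p * (p * r) > 1" using p1 by linarith
  let ?G = "cyclic_product {1..d - 1} p (p * (p * r))"
  show "p * (p * r) + (d - 1) * (p - 1) > 0 \<and> (\<forall>S. sequence_over ?G S \<and>
      size S \<ge> p * (p * r) + (d - 1) * (p - 1) \<longrightarrow> (\<exists>T. T \<subseteq># S \<and> T \<noteq> {#} \<and> zero_sum ?G T))"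
    using less_trans[OF zero_less_one n] zero_sum_subsequence_exists[OF assms]
    by (intro conjI allI impI) (auto simp only: add_gr_0)
  fix k assume k: "k > 0 \<and> (\<forall>S. sequence_over ?G S \<and> size S \<ge> k \<longrightarrow>
    (\<exists>T. T \<subseteq># S \<and> T \<noteq> {#} \<and> zero_sum ?G T))"
  obtain S where S: "sequence_over ?G S" "size S = (p * (p * r) - 1) + card {1..d - 1} * (p - 1)"
    "\<And>T. T \<subseteq># S \<Longrightarrow> zero_sum ?G T \<Longrightarrow> T = {#}"
    using zero_sum_free_sequence[OF p1 n, of "{1..d - 1}"] by auto
  \<comment> \<open>Otherwise \<open>S\<close> would contain a nonempty zero-sum subsequence. Its
    length is one less than the claimed value.\<close>
  then have "\<not> k \<le> size S" using k by blast
  moreover have "size S = (p * (p * r) - 1) + (d - 1) * (p - 1)"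
    using S(2) by (simp only: card_atLeastAtMost diff_Suc_1)
  ultimately show "p * (p * r) + (d - 1) * (p - 1) \<le> k" using n by linarith
qed

text \<open>Brings the group into the shape that \<open>davenport_star\<close> refers to, the large
  factor being placed at index \<open>d\<close>, last in the divisor chain.\<close>

lemma cyclic_product_iso:
  assumes "d > 0"
  shows "cyclic_product {1..d - 1} m n
    \<cong> product_group {1..d} (\<lambda>i. integer_mod_group (if i < d then m else n))"
proof -
  let ?G = "cyclic_product {1..d - 1} m n"
  let ?H = "product_group {1..d} (\<lambda>i. integer_mod_group (if i < d then m else n))"
  define h :: "(nat \<Rightarrow> int) \<times> int \<Rightarrow> nat \<Rightarrow> int"
    where "h x = (\<lambda>i\<in>{1..d}. if i < d then fst x i else snd x)" for x
  define g :: "(nat \<Rightarrow> int) \<Rightarrow> (nat \<Rightarrow> int) \<times> int"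
    where "g y = (\<lambda>i\<in>{1..d - 1}. y i, y d)" for y
  have "h \<in> hom ?G ?H"
    by (intro homI) (auto simp: h_def PiE_iff fun_eq_iff)
  moreover have "bij_betw h (carrier ?G) (carrier ?H)"
  proof (rule bij_betw_byWitness[where f' = g])
    show "\<forall>x\<in>carrier ?G. g (h x) = x"
      using assms by (auto simp: g_def h_def fun_eq_iff PiE_iff extensional_def)
    show "\<forall>y\<in>carrier ?H. h (g y) = y"
      using assms by (auto simp: g_def h_def fun_eq_iff PiE_iff extensional_def)
    show "h ` carrier ?G \<subseteq> carrier ?H"
      by (auto simp: h_def PiE_iff)
    show "g ` carrier ?H \<subseteq> carrier ?G"
    proof (rule image_subsetI)
      fix y assume "y \<in> carrier ?H"
      then have y: "y i \<in> carrier (integer_mod_group (if i < d then m else n))" if "i \<in> {1..d}" for i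
        using that unfolding carrier_product_group by (rule PiE_mem)
      have "y i \<in> carrier (integer_mod_group m)" if "i \<in> {1..d - 1}" for i
      proof -
        have "i \<in> {1..d}" "i < d" using that assms by auto
        with y[of i] show ?thesis by (simp only: if_True)
      qed
      moreover have "y d \<in> carrier (integer_mod_group n)" using y[of d] assms by simp
      ultimately show "g y \<in> carrier ?G" by (simp add: g_def)
    qed
  qed
  ultimately show ?thesis unfolding is_iso_def iso_def by blast
qed

lemma davenport_star_cyclic_product:
  assumes "d > 0" "m > 0" "n > 0" "m dvd n"
  shows "davenport_star (cyclic_product {1..d - 1} m n) = n + (d - 1) * (m - 1)"
proof -
  let ?n = "\<lambda>i. if i < d then m else n"
  have "davenport_star (cyclic_product {1..d - 1} m n) = 1 + (\<Sum>i=1..d. ?n i - 1)"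
    using assms
    by (intro davenport_star_eq group_cyclic_product cyclic_product_iso) (auto simp: divisor_chain_def)
  also have "{1..d} = insert d {1..<d}" using assms by auto
  also have "(\<Sum>i\<in>insert d {1..<d}. ?n i - 1) = (n - 1) + (d - 1) * (m - 1)"
    by simp
  finally show ?thesis using assms by simp
qed

theorem theorem7:
  fixes d :: nat
  assumes "d \<ge> 3"
  shows "\<exists>p0::nat. \<forall>p::nat. prime p \<and> p \<ge> p0 \<longrightarrow>
    (\<forall>q::nat. q > 0 \<and> gcd p q \<noteq> 1 \<longrightarrow>
      (let G = product_group {1..d - 1} (\<lambda>_. integer_mod_group p) \<times>\<times> integer_mod_group (p * q)
       in davenport G = davenport_star G \<and>
          davenport_star G = p * q + (d - 1) * (p - 1)))"
\<comment> \<open>The threshold is \<open>d\<close> itself, since the argument asks for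
  \<open>d \<le> p\<close>.\<close>
proof (intro exI[of _ d] allI impI)
  fix p q :: nat
  assume p: "prime p \<and> p \<ge> d" and q: "q > 0 \<and> gcd p q \<noteq> 1"
  \<comment> \<open>A prime that is not coprime to \<open>q\<close> divides it, so the large factor
    has order \<open>p * (p * r)\<close>.\<close>
  then have "p dvd q" by (metis coprime_iff_gcd_eq_1 prime_imp_coprime)
  then obtain r where r: "q = p * r" ..
  with q have "r > 0" "p > 0" by auto
  then have "davenport (cyclic_product {1..d - 1} p (p * q)) = p * q + (d - 1) * (p - 1)"
    and "davenport_star (cyclic_product {1..d - 1} p (p * q)) = p * q + (d - 1) * (p - 1)"
    using davenport_cyclic_product[of p d r] davenport_star_cyclic_product[of d p "p * q"] p q r assms
    by auto
  then show "let G = cyclic_product {1..d - 1} p (p * q)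
    in davenport G = davenport_star G \<and> davenport_star G = p * q + (d - 1) * (p - 1)"
    by (simp add: Let_def)
qed

end
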